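(* Let $\alpha_1,\dots,\alpha_6\in\mathbb{R}$ be Leslie coefficients with $\gamma_1\ne0$, and let $\beta_1,\beta_2,\beta_3$ be the associated constants. The inequality $$\beta_1(\mathbf{n}\mathbf{n}:\mathbf{D})^2+\beta_2\,\mathbf{D}:\mathbf{D}+\beta_3|\mathbf{D}\cdot\mathbf{n}|^2\ge 0$$ holds for every symmetric trace-free matrix $\mathbf{D}\in\mathbb{R}^{3\times3}$ and every unit vector $\mathbf{n}\in\mathbb{R}^3$ if and only if $$\beta_2\ge0,\qquad 2\beta_2+\beta_3\ge0,\qquad \tfrac32\beta_2+\beta_3+\beta_1\ge0 .$$
   Context: The Leslie coefficients are real constants $\alpha_1,\dots,\alpha_6$ satisfying $\alpha_2+\alpha_3=\alpha_6-\alpha_5$; one sets $\gamma_1=\alpha_3-\alpha_2$, $\gamma_2=\alpha_6-\alpha_5$, and $$\beta_1=\alpha_1+\frac{\gamma_2^2}{\gamma_1},\qquad \beta_2=\alpha_4,\qquad \beta_3=\alpha_5+\alpha_6-\frac{\gamma_2^2}{\gamma_1}.$$ Notation (repeated indices summed): $\mathbf{n}\mathbf{n}:\mathbf{D}=n_in_jD_{ij}$, $\mathbf{D}:\mathbf{D}=D_{ij}D_{ij}$, $(\mathbf{D}\cdot\mathbf{n})_i=D_{ij}n_j$, and $|\cdot|$ is the Euclidean norm. *)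

theory Defs
  imports "HOL-Analysis.Analysis"
begin

definition double_contract :: "real ^ 3 ^ 3 \<Rightarrow> real ^ 3 ^ 3 \<Rightarrow> real" where
  "double_contract A B = (\<Sum>i\<in>UNIV. \<Sum>j\<in>UNIV. A $ i $ j * B $ i $ j)"

text \<open>The dyad \<open>nn\<close> of the notation \<open>nn : D\<close>.\<close>

definition dyad :: "real ^ 3 \<Rightarrow> real ^ 3 \<Rightarrow> real ^ 3 ^ 3" where
  "dyad m n = (\<chi> i j. m $ i * n $ j)"

end

theory Submission
  imports Defs
begin

text \<open>Write \<open>a = nn : D\<close> and \<open>W = |D n|\<^sup>2\<close>. The traceless part of the restriction of \<open>D\<close> to the plane
  orthogonal to \<open>n\<close> has squared norm \<open>R = D : D - 2 W + a\<^sup>2 / 2\<close>, so the form equals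
  \<open>(2 \<beta>\<^sub>2 + \<beta>\<^sub>3) (W - a\<^sup>2) + (3/2 \<beta>\<^sub>2 + \<beta>\<^sub>3 + \<beta>\<^sub>1) a\<^sup>2 + \<beta>\<^sub>2 R\<close>.
  The three quantities \<open>W - a\<^sup>2\<close>, \<open>a\<^sup>2\<close> and \<open>R\<close> are nonnegative, and each of them
  can be nonzero while the other two vanish.\<close>

lemma double_contract_eq_inner: "double_contract A B = A \<bullet> B"
  by (simp add: double_contract_def inner_vec_def)

lemma inner_dyad: "dyad m n \<bullet> D = m \<bullet> (D *v n)"
  by (simp add: dyad_def inner_vec_def matrix_vector_mult_def sum_distrib_left mult_ac)

lemma dyad_vector_mult: "dyad m n *v x = (n \<bullet> x) *\<^sub>R m"
  by (simp add: dyad_def inner_vec_def matrix_vector_mult_def vec_eq_iff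
      sum_distrib_left sum_distrib_right mult_ac)

lemma inner_mat_1: "mat 1 \<bullet> (A :: real ^ 'n ^ 'n) = trace A"
  by (simp add: inner_vec_def mat_def trace_def if_distrib [where f = "\<lambda>x. x * _"] cong: if_cong)

lemma trace_dyad: "trace (dyad x y) = x \<bullet> y"
  by (simp add: trace_def dyad_def inner_vec_def)

text \<open>This is R \<ge> 0. The right side minus the left is \<open>E \<bullet> E\<close>, where
  \<open>E\<close> is the compression of \<open>D\<close> to the plane orthogonal to
  \<open>n\<close>, made traceless.\<close>

lemma inner_square_traceless_symmetric_ge:
  fixes D :: "real ^ 3 ^ 3" and n :: "real ^ 3"
  assumes sym: "transpose D = D" and tr: "trace D = 0" and unit: "norm n = 1"
  shows "2 * (norm (D *v n))\<^sup>2 \<le> D \<bullet> D + (n \<bullet> (D *v n))\<^sup>2 / 2"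
proof -
  define w a where "w = D *v n" and "a = n \<bullet> w"
  \<comment> \<open>This is \<open>P D P + (a/2) P\<close> with \<open>P = I - n n\<^sup>T\<close>.\<close>
  define E where
    "E = D - dyad n w - dyad w n + (a / 2) *\<^sub>R dyad n n + (a / 2) *\<^sub>R mat 1"
  have nn: "n \<bullet> n = 1"
    using unit by (simp add: norm_eq_1)
  have wn: "w \<bullet> n = a" "n \<bullet> w = a"
    by (simp_all add: a_def inner_commute)
  \<comment> \<open>Symmetry moves \<open>D\<close> onto \<open>n\<close>, and \<open>D *v n\<close>
    is \<open>w\<close>.\<close>
  have nDw: "n \<bullet> (D *v w) = w \<bullet> w"
    using dot_lmul_matrix[of n D w] sym by (simp add: w_def transpose_matrix_vector[symmetric])
  have dyad_D: "dyad n w \<bullet> D = w \<bullet> w" "dyad w n \<bullet> D = w \<bullet> w" "dyad n n \<bullet> D = a"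
    by (simp_all add: inner_dyad nDw w_def[symmetric] wn)
  have dyad_mat: "dyad x y \<bullet> mat 1 = x \<bullet> y" for x y
    by (simp add: inner_dyad)
  have D_dyad: "D \<bullet> dyad n w = w \<bullet> w" "D \<bullet> dyad w n = w \<bullet> w" "D \<bullet> dyad n n = a"
    using dyad_D by (simp_all only: inner_commute[of D])
  have D_mat: "D \<bullet> mat 1 = 0"
    using inner_mat_1[of D] tr by (simp only: inner_commute[of D])
  have dyad_dyad: "dyad x y \<bullet> dyad x' y' = (x \<bullet> x') * (y' \<bullet> y)" for x y x' y'
    by (simp add: inner_dyad dyad_vector_mult)
  \<comment> \<open>\<open>P D P\<close> has squared norm
    \<open>D \<bullet> D - 2 * (w \<bullet> w)\<close> plus a^2 and trace -a. Adding (a/2) P, where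
    P has trace 2, contributes -a^2 from the cross terms and a^2/2 from its own square.\<close>
  have "E \<bullet> E = D \<bullet> D + a\<^sup>2 / 2 - 2 * (w \<bullet> w)"
    by (simp add: E_def inner_simps dyad_D dyad_mat dyad_dyad inner_mat_1 tr nn wn D_dyad D_mat
        trace_dyad trace_I power2_eq_square algebra_simps)
  moreover have "E \<bullet> E \<ge> 0"
    by simp
  ultimately show ?thesis
    by (simp add: power2_norm_eq_inner a_def w_def)
qed

theorem proposition2p2:
  fixes \<alpha>\<^sub>1 \<alpha>\<^sub>2 \<alpha>\<^sub>3 \<alpha>\<^sub>4 \<alpha>\<^sub>5 \<alpha>\<^sub>6 \<gamma>\<^sub>1 \<gamma>\<^sub>2 \<beta>\<^sub>1 \<beta>\<^sub>2 \<beta>\<^sub>3 :: real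
  assumes "\<alpha>\<^sub>2 + \<alpha>\<^sub>3 = \<alpha>\<^sub>6 - \<alpha>\<^sub>5"
    and "\<gamma>\<^sub>1 = \<alpha>\<^sub>3 - \<alpha>\<^sub>2"
    and "\<gamma>\<^sub>2 = \<alpha>\<^sub>6 - \<alpha>\<^sub>5"
    and "\<gamma>\<^sub>1 \<noteq> 0"
    and "\<beta>\<^sub>1 = \<alpha>\<^sub>1 + \<gamma>\<^sub>2\<^sup>2 / \<gamma>\<^sub>1"
    and "\<beta>\<^sub>2 = \<alpha>\<^sub>4"
    and "\<beta>\<^sub>3 = \<alpha>\<^sub>5 + \<alpha>\<^sub>6 - \<gamma>\<^sub>2\<^sup>2 / \<gamma>\<^sub>1"
  shows "(\<forall>(D :: real ^ 3 ^ 3) (n :: real ^ 3). transpose D = D \<and> trace D = 0 \<and> norm n = 1 \<longrightarrow>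
            \<beta>\<^sub>1 * (double_contract (dyad n n) D)\<^sup>2 + \<beta>\<^sub>2 * double_contract D D
              + \<beta>\<^sub>3 * (norm (D *v n))\<^sup>2 \<ge> 0)
         \<longleftrightarrow> \<beta>\<^sub>2 \<ge> 0 \<and> 2 * \<beta>\<^sub>2 + \<beta>\<^sub>3 \<ge> 0 \<and> 3 / 2 * \<beta>\<^sub>2 + \<beta>\<^sub>3 + \<beta>\<^sub>1 \<ge> 0"
proof -
  let ?Q = "\<lambda>(D :: real ^ 3 ^ 3) (n :: real ^ 3). \<beta>\<^sub>1 * (double_contract (dyad n n) D)\<^sup>2
    + \<beta>\<^sub>2 * double_contract D D + \<beta>\<^sub>3 * (norm (D *v n))\<^sup>2"
  show ?thesis
  proof (intro iffI allI impI)
    assume Q: "\<forall>(D :: real ^ 3 ^ 3) (n :: real ^ 3).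
      transpose D = D \<and> trace D = 0 \<and> norm n = 1 \<longrightarrow> ?Q D n \<ge> 0"
    define e :: "real ^ 3" where "e = vector [1, 0, 0]"
    \<comment> \<open>With n = \<open>e\<close>, each matrix isolates one term of the decomposition:
      \<open>A\<close> has only R = 2 nonzero, \<open>B\<close> only W - a^2 = 1, and
      \<open>C\<close> only a^2 = 4. The form is therefore a positive multiple of one coefficient
      each time.\<close>
    define A B C :: "real ^ 3 ^ 3"
      where "A = vector [vector [0, 0, 0], vector [0, 1, 0], vector [0, 0, -1]]"
        and "B = vector [vector [0, 1, 0], vector [1, 0, 0], vector [0, 0, 0]]"
        and "C = vector [vector [2, 0, 0], vector [0, -1, 0], vector [0, 0, -1]]"
    note calc = transpose_def trace_def vec_eq_iff forall_3 sum_3 norm_eq_1 inner_vec_def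
      dyad_def double_contract_def matrix_vector_mult_def power2_norm_eq_inner
    have "?Q A e \<ge> 0" "?Q B e \<ge> 0" "?Q C e \<ge> 0"
      by (rule Q[rule_format]; simp add: A_def B_def C_def e_def calc)+
    then show "\<beta>\<^sub>2 \<ge> 0 \<and> 2 * \<beta>\<^sub>2 + \<beta>\<^sub>3 \<ge> 0 \<and> 3 / 2 * \<beta>\<^sub>2 + \<beta>\<^sub>3 + \<beta>\<^sub>1 \<ge> 0"
      by (simp add: A_def B_def C_def e_def calc)
  next
    fix D :: "real ^ 3 ^ 3" and n :: "real ^ 3"
    assume \<beta>: "\<beta>\<^sub>2 \<ge> 0 \<and> 2 * \<beta>\<^sub>2 + \<beta>\<^sub>3 \<ge> 0 \<and> 3 / 2 * \<beta>\<^sub>2 + \<beta>\<^sub>3 + \<beta>\<^sub>1 \<ge> 0"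
      and D: "transpose D = D \<and> trace D = 0 \<and> norm n = 1"
    define a W where "a = n \<bullet> (D *v n)" and "W = (norm (D *v n))\<^sup>2"
    have "\<bar>a\<bar> \<le> norm (D *v n)"
      using Cauchy_Schwarz_ineq2[of n "D *v n"] D by (simp add: a_def)
    then have "a\<^sup>2 \<le> W"
      unfolding W_def by (metis abs_ge_zero power2_abs power_mono)
    moreover have "2 * W \<le> double_contract D D + a\<^sup>2 / 2"
      using inner_square_traceless_symmetric_ge[of D n] D
      by (simp add: double_contract_eq_inner a_def W_def)
    ultimately have "0 \<le> (2 * \<beta>\<^sub>2 + \<beta>\<^sub>3) * (W - a\<^sup>2)"
      "0 \<le> (3 / 2 * \<beta>\<^sub>2 + \<beta>\<^sub>3 + \<beta>\<^sub>1) * a\<^sup>2"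
      "0 \<le> \<beta>\<^sub>2 * (double_contract D D - 2 * W + a\<^sup>2 / 2)"
      using \<beta> by (simp_all only: mult_nonneg_nonneg zero_le_power2 diff_ge_0_iff_ge)
    then have "0 \<le> (2 * \<beta>\<^sub>2 + \<beta>\<^sub>3) * (W - a\<^sup>2) + (3 / 2 * \<beta>\<^sub>2 + \<beta>\<^sub>3 + \<beta>\<^sub>1) * a\<^sup>2
        + \<beta>\<^sub>2 * (double_contract D D - 2 * W + a\<^sup>2 / 2)"
      by linarith
    \<comment> \<open>Collecting terms, W keeps the coefficient \<open>\<beta>\<^sub>3\<close>, a^2
      keeps \<open>\<beta>\<^sub>1\<close>, and D : D keeps \<open>\<beta>\<^sub>2\<close>.\<close>
    also have "\<dots> = ?Q D n"
      by (simp add: double_contract_eq_inner inner_dyad a_def W_def algebra_simps)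
    finally show "?Q D n \<ge> 0" .
  qed
qed

end
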